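(* Let $n=tr$ with $t,r>1$, let $f\in\mathcal{L}_{t,q}$ be a scattered polynomial, let $a,b\in\mathbb{F}_{q^t}$ with $b\neq 0$, and let $\omega\in\mathbb{F}_{q^n}$ be such that $\{1,\omega,\ldots,\omega^{r-1}\}$ is an $\mathbb{F}_{q^t}$-basis of $\mathbb{F}_{q^n}$. Let $U_{a,b}=\{(f(x_0)-ax_0,\ bx_0+\sum_{i=1}^{r-1}x_i\omega^i) : x_0,\ldots,x_{r-1}\in\mathbb{F}_{q^t}\}$. Then $L_{U_{a,b}}$ is $\mathrm{PGL}(2,q^n)$-equivalent to $L_{U_p}$, where $U_p=\{(x,p(x)) : x\in\mathbb{F}_{q^n}\}$ and $p(x)=\mathrm{Tr}_{q^n/q^t}(f(x)-ax)$.
   Context: $q$ is a prime power. $\mathcal{L}_{t,q}$ is the set of $q$-polynomials $\sum_i c_ix^{q^i}$ with coefficients in $\mathbb{F}_{q^t}$ (viewed also as maps on $\mathbb{F}_{q^n}$). $f\in\mathcal{L}_{t,q}$ is scattered if $\dim_{\mathbb{F}_q}\ker(f(x)-mx)\le 1$ on $\mathbb{F}_{q^t}$ for all $m\in\mathbb{F}_{q^t}$. $\mathrm{Tr}_{q^n/q^t}(x)=\sum_{j=0}^{r-1}x^{q^{tj}}$. For an $\mathbb{F}_q$-subspace $U$ of $\mathbb{F}_{q^n}^2$, $L_U=\{\langle u\rangle_{\mathbb{F}_{q^n}}: u\in U\setminus\{0\}\}\subseteq\mathrm{PG}(1,q^n)$; linear sets are $\mathrm{PGL}(2,q^n)$-equivalent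 if a projectivity maps one onto the other. *)

theory Defs
  imports "HOL-Algebra.Embedded_Algebras" "HOL-Algebra.Polynomials"
    "HOL-Number_Theory.Prime_Powers"
begin

text \<open>
  Throughout, \<open>R\<close> plays the role of the finite field of order \<open>q^n\<close>, and its subfields are
  given as subsets of the carrier. A \<open>q\<close>-polynomial with coefficients in a subfield is a formal
  univariate polynomial; it is turned into a map on all of \<open>R\<close> by \<open>ring.eval\<close>.
\<close>

definition q_polys :: "('a, 'b) ring_scheme \<Rightarrow> nat \<Rightarrow> 'a set \<Rightarrow> 'a list set" where
  "q_polys R q F =
    {f \<in> carrier (univ_poly R F). \<forall>k. ring.coeff R f k \<noteq> \<zero>\<^bsub>R\<^esub> \<longrightarrow> (\<exists>i. k = q ^ i)}"

text \<open>Here \<open>K\<close> is the field of order \<open>q\<close> over which dimensions are taken, and the kernels are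
  taken in \<open>F\<close>, not in \<open>R\<close>.\<close>

definition scattered :: "('a, 'b) ring_scheme \<Rightarrow> 'a set \<Rightarrow> 'a set \<Rightarrow> 'a list \<Rightarrow> bool" where
  "scattered R K F f \<longleftrightarrow>
    (\<forall>m\<in>F. \<exists>d\<le>1. ring.dimension R d K
       {x \<in> F. ring.eval R f x \<ominus>\<^bsub>R\<^esub> m \<otimes>\<^bsub>R\<^esub> x = \<zero>\<^bsub>R\<^esub>})"

definition is_basis :: "('a, 'b) ring_scheme \<Rightarrow> 'a set \<Rightarrow> 'a list \<Rightarrow> bool" where
  "is_basis R F us \<longleftrightarrow> ring.independent R F us \<and> ring.Span R F us = carrier R"

definition rel_trace :: "('a, 'b) ring_scheme \<Rightarrow> nat \<Rightarrow> nat \<Rightarrow> nat \<Rightarrow> 'a \<Rightarrow> 'a" where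
  "rel_trace R q t r x = (\<Oplus>\<^bsub>R\<^esub>j\<in>{..<r}. x [^]\<^bsub>R\<^esub> (q ^ (t * j)))"

text \<open>Points of the projective line over \<open>R\<close> are the one-dimensional subspaces of \<open>R\<^sup>2\<close>, as sets
  of pairs.\<close>

definition proj_point :: "('a, 'b) ring_scheme \<Rightarrow> 'a \<times> 'a \<Rightarrow> ('a \<times> 'a) set" where
  "proj_point R u = {(c \<otimes>\<^bsub>R\<^esub> fst u, c \<otimes>\<^bsub>R\<^esub> snd u) | c. c \<in> carrier R}"

definition linear_set :: "('a, 'b) ring_scheme \<Rightarrow> ('a \<times> 'a) set \<Rightarrow> ('a \<times> 'a) set set" where
  "linear_set R U = proj_point R ` (U - {(\<zero>\<^bsub>R\<^esub>, \<zero>\<^bsub>R\<^esub>)})"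

definition mat2_apply ::
    "('a, 'b) ring_scheme \<Rightarrow> 'a \<Rightarrow> 'a \<Rightarrow> 'a \<Rightarrow> 'a \<Rightarrow> 'a \<times> 'a \<Rightarrow> 'a \<times> 'a" where
  "mat2_apply R a b c d v =
    (a \<otimes>\<^bsub>R\<^esub> fst v \<oplus>\<^bsub>R\<^esub> b \<otimes>\<^bsub>R\<^esub> snd v, c \<otimes>\<^bsub>R\<^esub> fst v \<oplus>\<^bsub>R\<^esub> d \<otimes>\<^bsub>R\<^esub> snd v)"

definition projectivities ::
    "('a, 'b) ring_scheme \<Rightarrow> (('a \<times> 'a) set \<Rightarrow> ('a \<times> 'a) set) set" where
  "projectivities R =
    {(`) (mat2_apply R a b c d) | a b c d.
       a \<in> carrier R \<and> b \<in> carrier R \<and> c \<in> carrier R \<and> d \<in> carrier R \<and>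
       a \<otimes>\<^bsub>R\<^esub> d \<ominus>\<^bsub>R\<^esub> b \<otimes>\<^bsub>R\<^esub> c \<noteq> \<zero>\<^bsub>R\<^esub>}"

definition PGL_equivalent ::
    "('a, 'b) ring_scheme \<Rightarrow> ('a \<times> 'a) set set \<Rightarrow> ('a \<times> 'a) set set \<Rightarrow> bool" where
  "PGL_equivalent R S T \<longleftrightarrow> (\<exists>\<phi>\<in>projectivities R. \<phi> ` S = T)"

definition U_ab ::
    "('a, 'b) ring_scheme \<Rightarrow> 'a set \<Rightarrow> nat \<Rightarrow> 'a list \<Rightarrow> 'a \<Rightarrow> 'a \<Rightarrow> 'a \<Rightarrow> ('a \<times> 'a) set" where
  "U_ab R F r f \<omega> a b =
    {(ring.eval R f (x 0) \<ominus>\<^bsub>R\<^esub> a \<otimes>\<^bsub>R\<^esub> x 0,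
      b \<otimes>\<^bsub>R\<^esub> x 0 \<oplus>\<^bsub>R\<^esub> (\<Oplus>\<^bsub>R\<^esub>i\<in>{1..r - 1}. x i \<otimes>\<^bsub>R\<^esub> \<omega> [^]\<^bsub>R\<^esub> i))
     | x :: nat \<Rightarrow> 'a. \<forall>i<r. x i \<in> F}"

definition U_graph :: "('a, 'b) ring_scheme \<Rightarrow> ('a \<Rightarrow> 'a) \<Rightarrow> ('a \<times> 'a) set" where
  "U_graph R p = {(x, p x) | x. x \<in> carrier R}"

end

theory Submission
  imports Defs
begin

text \<open>
  Put \<open>g(x) = f(x) - a x\<close>. The coefficients of \<open>g\<close> are fixed by \<open>x \<mapsto> x^(q^t)\<close> and \<open>g\<close> is
  additive, so \<open>g\<close> commutes with the trace \<open>Tr\<close> and \<open>p(x) = g(Tr x)\<close>. The trace form is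
  nondegenerate, hence some nonzero \<open>\<alpha>\<close> satisfies \<open>Tr \<alpha> = 1\<close> and \<open>Tr (\<alpha> \<omega>^i) = 0\<close> for
  \<open>0 < i < r\<close>. If \<open>y = b x\<^sub>0 + x\<^sub>1 \<omega> + \<dots>\<close>, then \<open>Tr ((\<alpha> / b) y) = x\<^sub>0\<close>, so the projectivity
  induced by \<open>(u, y) \<mapsto> ((\<alpha> / b) y, u)\<close> maps \<open>U_ab\<close> onto the graph of \<open>p\<close>.
\<close>

section \<open>Binomial expansion and Frobenius maps in prime characteristic\<close>

lemma (in cring) binomial_expansion:
  assumes x: "x \<in> carrier R" and y: "y \<in> carrier R"
  shows "(x \<oplus> y) [^] n = (\<Oplus>k\<in>{..n}. [(n choose k)] \<cdot> (x [^] k \<otimes> y [^] (n - k)))"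
proof (induction n)
  case 0
  then show ?case by (simp add: x y)
next
  case (Suc n)
  let ?T = "\<lambda>n k. [(n choose k)] \<cdot> (x [^] k \<otimes> y [^] (n - k))"
  let ?U = "\<lambda>k. [(n choose k)] \<cdot> (x [^] Suc k \<otimes> y [^] (n - k))"
  let ?V = "\<lambda>k. [(n choose k)] \<cdot> (x [^] k \<otimes> y [^] (Suc n - k))"
  note closed = Pi_def x y
  have left: "x \<otimes> (\<Oplus>k\<in>{..n}. ?T n k) = (\<Oplus>k\<in>{..n}. ?U k)"
    by (subst finsum_rdistr)
      (auto simp: closed add_pow_rdistr m_ac intro!: finsum_cong)
  have "y \<otimes> (\<Oplus>k\<in>{..n}. ?T n k) = (\<Oplus>k\<in>{..n}. ?V k)"
    by (subst finsum_rdistr)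
      (auto simp: closed add_pow_rdistr m_ac Suc_diff_le intro!: finsum_cong)
  \<comment> \<open>The extra term \<open>k = Suc n\<close> vanishes because
    \<open>n choose Suc n\<close> is 0. With it the index can be shifted by one, so that
    \<open>?U k\<close> and \<open>?V (Suc k)\<close> carry the same monomial and Pascal's rule
    applies termwise.\<close>
  also have "\<dots> = (\<Oplus>k\<in>{..Suc n}. ?V k)"
    by (subst finsum_Suc) (auto simp: closed binomial_eq_0)
  also have "\<dots> = (\<Oplus>k\<in>{..n}. ?V (Suc k)) \<oplus> ?V 0"
    by (rule finsum_Suc2) (auto simp: closed)
  finally have right: "y \<otimes> (\<Oplus>k\<in>{..n}. ?T n k) = (\<Oplus>k\<in>{..n}. ?V (Suc k)) \<oplus> ?V 0" .
  have "(\<Oplus>k\<in>{..Suc n}. ?T (Suc n) k) = (\<Oplus>k\<in>{..n}. ?T (Suc n) (Suc k)) \<oplus> ?T (Suc n) 0"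
    by (rule finsum_Suc2) (auto simp: closed)
  also have "(\<Oplus>k\<in>{..n}. ?T (Suc n) (Suc k)) = (\<Oplus>k\<in>{..n}. ?U k \<oplus> ?V (Suc k))"
    by (intro finsum_cong) (auto simp: closed add.nat_pow_mult simp flip: add.nat_pow_mult)
  also have "\<dots> = (\<Oplus>k\<in>{..n}. ?U k) \<oplus> (\<Oplus>k\<in>{..n}. ?V (Suc k))"
    by (rule finsum_addf) (auto simp: closed)
  finally have "(\<Oplus>k\<in>{..Suc n}. ?T (Suc n) k) =
      (\<Oplus>k\<in>{..n}. ?U k) \<oplus> ((\<Oplus>k\<in>{..n}. ?V (Suc k)) \<oplus> ?V 0)"
    by (simp add: closed a_assoc)
  also have "\<dots> = (x \<oplus> y) \<otimes> (\<Oplus>k\<in>{..n}. ?T n k)"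
    unfolding left[symmetric] right[symmetric] by (subst l_distr) (auto simp: closed)
  also have "\<dots> = (x \<oplus> y) [^] Suc n"
    using Suc x y by (simp add: m_comm)
  finally show ?case by simp
qed

lemma (in cring) add_pow_eq_zero:
  assumes "[(p::nat)] \<cdot> \<one> = \<zero>" and "p dvd m" and x: "x \<in> carrier R"
  shows "[m] \<cdot> x = \<zero>"
proof -
  obtain k where m: "m = p * k" using assms by blast
  have "[m] \<cdot> \<one> = [k] \<cdot> ([p] \<cdot> \<one>)"
    unfolding m by (rule add.nat_pow_pow[symmetric]) simp
  then have "[m] \<cdot> \<one> = \<zero>" using assms by simp
  moreover have "([m] \<cdot> \<one>) \<otimes> x = [m] \<cdot> x"
    using x by (simp add: add_pow_ldistr)
  ultimately show ?thesis using x by simp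
qed

text \<open>For \<open>0 < k < p\<close> the prime \<open>p\<close> divides
  \<open>p choose k\<close>, so only the two outer terms of the binomial expansion survive.\<close>

lemma (in cring) prime_char_pow_add:
  assumes p: "prime (p::nat)" "[p] \<cdot> \<one> = \<zero>" and x: "x \<in> carrier R" and y: "y \<in> carrier R"
  shows "(x \<oplus> y) [^] p = x [^] p \<oplus> y [^] p"
proof -
  let ?T = "\<lambda>k. [(p choose k)] \<cdot> (x [^] k \<otimes> y [^] (p - k))"
  have "p > 0" using p(1) prime_gt_0_nat by blast
  have "(x \<oplus> y) [^] p = (\<Oplus>k\<in>{..p}. ?T k)"
    by (rule binomial_expansion[OF x y])
  also have "\<dots> = (\<Oplus>k\<in>{0, p}. ?T k)"
  proof (rule add.finprod_mono_neutral_cong_right)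
    fix k assume "k \<in> {..p} - {0, p}"
    then have "p dvd p choose k"
      using p(1) by (intro dvd_choose_prime) auto
    then show "?T k = \<zero>"
      using x y by (intro add_pow_eq_zero[OF p(2)]) auto
  qed (use x y in auto)
  also have "\<dots> = x [^] p \<oplus> y [^] p"
    using x y \<open>p > 0\<close> by (simp add: a_comm)
  finally show ?thesis .
qed

lemma (in cring) prime_char_pow_hom:
  assumes "prime (p::nat)" "[p] \<cdot> \<one> = \<zero>"
  shows "(\<lambda>x. x [^] (p ^ i)) \<in> ring_hom R R"
proof -
  have "(x \<oplus> y) [^] (p ^ i) = x [^] (p ^ i) \<oplus> y [^] (p ^ i)"
    if "x \<in> carrier R" "y \<in> carrier R" for x y
    using that
  proof (induction i)
    case (Suc i)
    have pow: "z [^] (p ^ Suc i) = (z [^] (p ^ i)) [^] p" if "z \<in> carrier R" for z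
      using nat_pow_pow[OF that, of "p ^ i" p] by (simp add: mult.commute)
    show ?case
      using Suc by (simp only: pow a_closed prime_char_pow_add[OF assms] nat_pow_closed)
  qed simp
  then show ?thesis
    by (auto intro!: ring_hom_memI simp: nat_pow_distrib)
qed

text \<open>The order of the additive group annihilates \<open>\<one>\<close>, so
  \<open>[(p ^ m)] \<cdot> \<one>\<close> is zero. This element is the \<open>m\<close>-th power of
  \<open>[p] \<cdot> \<one>\<close>, and a domain has no nonzero nilpotent elements.\<close>

lemma (in domain) prime_power_card_char:
  assumes "card (carrier R) = p ^ m" "m > 0" "finite (carrier R)"
  shows "[(p::nat)] \<cdot> \<one> = \<zero>"
proof -
  have "[(p ^ m)] \<cdot> \<one> = ([p] \<cdot> \<one>) [^] m" for m
  proof (induction m)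
    case (Suc m)
    have "[(p ^ Suc m)] \<cdot> \<one> = [p] \<cdot> ([(p ^ m)] \<cdot> \<one>)"
      by (simp add: add.nat_pow_pow mult.commute)
    also have "\<dots> = ([(p ^ m)] \<cdot> \<one>) \<otimes> ([p] \<cdot> \<one>)"
      by (simp add: add_pow_rdistr)
    finally show ?case by (simp add: Suc)
  qed simp
  moreover have "[(order R)] \<cdot> \<one> = \<zero>"
    using add.pow_order_eq_1[of \<one>] by (simp add: order_def)
  ultimately have "([p] \<cdot> \<one>) [^] m = \<zero>"
    using assms by (simp add: order_def)
  moreover have "x [^] m \<noteq> \<zero>" if "x \<in> carrier R" "x \<noteq> \<zero>" for x and m :: nat
    using that by (induction m) (auto simp: integral_iff)
  ultimately show ?thesis by (metis add.nat_pow_closed one_closed)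
qed

section \<open>Powers and power sums over finite fields\<close>

lemma (in field) pow_card_eq_self:
  assumes "finite (carrier R)" and x: "x \<in> carrier R"
  shows "x [^] card (carrier R) = x"
proof (cases "x = \<zero>")
  case True
  then show ?thesis using assms by (metis card_gt_0_iff empty_iff nat_pow_zero neq0_conv)
next
  case False
  interpret M: group "Multiplicative_Group.mult_of R"
    by (rule field_mult_group)
  have "x [^]\<^bsub>Multiplicative_Group.mult_of R\<^esub> order (Multiplicative_Group.mult_of R) = \<one>"
    using M.pow_order_eq_1[of x] x False by simp
  then have "x [^] (card (carrier R) - 1) = \<one>"
    using assms by (simp add: Multiplicative_Group.nat_pow_mult_of order_mult_of order_def)
  moreover have "card (carrier R) = Suc (card (carrier R) - 1)"
    using assms by (metis card_gt_0_iff empty_iff Suc_pred')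
  ultimately show ?thesis using x by (metis l_one nat_pow_Suc)
qed

text \<open>The power sum is the value of a nonzero polynomial of degree at most
  \<open>Max A\<close>. This is less than the number of elements of the domain, so not all of them
  can be roots.\<close>

lemma (in domain) exists_nonroot_of_power_sum:
  assumes fin: "finite (carrier R)" and A: "finite A" "A \<noteq> {}"
    and less: "\<And>e. e \<in> A \<Longrightarrow> e < card (carrier R)"
  shows "\<exists>x\<in>carrier R. (\<Oplus>e\<in>A. x [^] (e::nat)) \<noteq> \<zero>"
proof (rule ccontr)
  assume *: "\<not> ?thesis"
  interpret UP: UP_domain R "UP R" by unfold_locales
  let ?m = "\<lambda>e. UnivPoly.monom (UP R) \<one> e"
  define P where "P = (\<Oplus>\<^bsub>UP R\<^esub>e\<in>A. ?m e)"
  have m: "?m \<in> A \<rightarrow> carrier (UP R)" by simp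
  then have P: "P \<in> carrier (UP R)"
    unfolding P_def by (rule UP.P.finsum_closed)
  have coeff: "up_ring.coeff (UP R) P k = (\<Oplus>e\<in>A. if e = k then \<one> else \<zero>)" for k
    unfolding P_def by (subst UP.coeff_finsum[OF A(1) m]) simp
  have eval: "UnivPoly.eval R R id x P = \<zero>" if x: "x \<in> carrier R" for x
  proof -
    interpret U: UP_pre_univ_prop R R id "UP R" by unfold_locales simp
    interpret E: ring_hom_cring "UP R" R "UnivPoly.eval R R id x"
      by unfold_locales (rule U.eval_ring_hom[OF x])
    have "UnivPoly.eval R R id x P = (\<Oplus>e\<in>A. x [^] e)"
      unfolding P_def E.hom_finsum[OF m] using x
      by (intro finsum_cong) (auto simp: U.eval_monom simp_implies_def)
    then show ?thesis using * x by simp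
  qed
  \<comment> \<open>Since \<open>A\<close> is a set, its exponents are distinct: exactly one
    monomial contributes to this coefficient, and nothing cancels.\<close>
  have "up_ring.coeff (UP R) P (Max A) \<noteq> \<zero>"
    unfolding coeff using A add.finprod_singleton_swap[of "Max A" A "\<lambda>_. \<one>"] by simp
  then have "P \<noteq> \<zero>\<^bsub>UP R\<^esub>" by auto
  from UP.roots_bound[OF P this fin]
  have "card {x \<in> carrier R. UnivPoly.eval R R id x P = \<zero>} \<le> deg R P"
    by simp
  moreover have "{x \<in> carrier R. UnivPoly.eval R R id x P = \<zero>} = carrier R"
    using eval by auto
  moreover have "deg R P \<le> Max A"
  proof (rule UP.deg_aboveI[OF _ P])
    fix k assume "Max A < k"
    then have "\<forall>e\<in>A. e \<noteq> k" using A Max_ge by fastforce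
    then show "up_ring.coeff (UP R) P k = \<zero>"
      unfolding coeff by (intro add.finprod_one_eqI) auto
  qed
  ultimately show False using less[OF Max_in[OF A]] by simp
qed

section \<open>Linear combinations and additive maps\<close>

lemma (in ring) combine_map_upt_eq_finsum:
  assumes "set ks \<subseteq> carrier R" "\<And>i. w i \<in> carrier R"
  shows "combine ks (map w [0..<length ks]) = (\<Oplus>i\<in>{..<length ks}. ks ! i \<otimes> w i)"
  using assms
proof (induction ks arbitrary: w)
  case (Cons k ks)
  let ?n = "length ks"
  have nth: "ks ! i \<in> carrier R" if "i < ?n" for i
    using Cons.prems(1) that nth_mem by fastforce
  have "(\<Oplus>i\<in>{..<Suc ?n}. (k # ks) ! i \<otimes> w i)
      = k \<otimes> w 0 \<oplus> (\<Oplus>i\<in>Suc ` {..<?n}. (k # ks) ! i \<otimes> w i)"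
    unfolding lessThan_Suc_eq_insert_0 using Cons.prems nth
    by (subst finsum_insert) (auto simp: Pi_def)
  also have "(\<Oplus>i\<in>Suc ` {..<?n}. (k # ks) ! i \<otimes> w i) = (\<Oplus>i\<in>{..<?n}. ks ! i \<otimes> w (Suc i))"
    using Cons.prems nth by (subst finsum_reindex) (auto simp: Pi_def)
  \<comment> \<open>The tail of the list is paired with the shifted family \<open>w (Suc i)\<close>,
    which is why the induction leaves \<open>w\<close> arbitrary.\<close>
  also have "\<dots> = combine ks (map (\<lambda>i. w (Suc i)) [0..<?n])"
    using Cons by simp
  finally show ?case
    by (simp add: upt_conv_Cons map_Suc_upt[symmetric] comp_def del: upt_Suc)
qed simp

text \<open>Stated for any additive function, so that it serves the Frobenius powers, the trace and
  the maps that commute with the trace alike.\<close>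

lemma (in abelian_group) additive_finsum:
  assumes g: "g \<in> carrier G \<rightarrow> carrier G"
    and add: "\<And>x y. x \<in> carrier G \<Longrightarrow> y \<in> carrier G \<Longrightarrow> g (x \<oplus> y) = g x \<oplus> g y"
    and h: "h \<in> A \<rightarrow> carrier G" and "finite A"
  shows "g (\<Oplus>i\<in>A. h i) = (\<Oplus>i\<in>A. g (h i))"
  using \<open>finite A\<close> h
proof (induction A rule: finite_induct)
  case empty
  have "g \<zero> \<oplus> g \<zero> = g \<zero> \<oplus> \<zero>"
    using add[of \<zero> \<zero>] g by (simp add: Pi_def)
  then have "g \<zero> = \<zero>"
    using g by (metis Pi_iff add.l_cancel zero_closed)
  then show ?case by simp
next
  case (insert i A)
  have "(\<Oplus>j\<in>A. h j) \<in> carrier G" using insert.prems by (intro finsum_closed) auto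
  moreover have "(\<lambda>i. g (h i)) \<in> A \<rightarrow> carrier G" using insert.prems g by auto
  ultimately show ?case
    using insert g by (auto simp: add Pi_def)
qed

text \<open>A polynomial is additive as soon as each of its monomials is. The hypothesis on
  \<open>f\<close> admits leading zeros because the induction strips leading coefficients, and the
  tail of a normalised list may begin with zeros.\<close>

lemma (in ring) eval_additive_of_support:
  assumes f: "set f \<subseteq> carrier R"
    and supp: "\<And>k. coeff f k \<noteq> \<zero> \<Longrightarrow> k \<in> E"
    and add: "\<And>k x y. k \<in> E \<Longrightarrow> x \<in> carrier R \<Longrightarrow> y \<in> carrier R
      \<Longrightarrow> (x \<oplus> y) [^] k = x [^] k \<oplus> y [^] (k::nat)"
    and x: "x \<in> carrier R" and y: "y \<in> carrier R"
  shows "eval f (x \<oplus> y) = eval f x \<oplus> eval f y"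
  using f supp
proof (induction f)
  case Nil
  then show ?case by simp
next
  case (Cons c f)
  have "coeff (c # f) k = coeff f k" if "coeff f k \<noteq> \<zero>" for k
    using that coeff_length[of f k] by (cases "k \<ge> length f") auto
  then have IH: "eval f (x \<oplus> y) = eval f x \<oplus> eval f y"
    using Cons by auto
  have c: "c \<in> carrier R" using Cons.prems by simp
  have ev: "eval f x \<in> carrier R" "eval f y \<in> carrier R"
    using Cons.prems x y by (auto intro!: eval_in_carrier)
  have "c \<otimes> (x \<oplus> y) [^] length f = c \<otimes> x [^] length f \<oplus> c \<otimes> y [^] length f"
  proof (cases "c = \<zero>")
    case False
    then have "length f \<in> E" using Cons.prems(2)[of "length f"] by simp
    then show ?thesis using add x y c by (simp add: r_distr)
  qed (use x y in simp)
  then show ?case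
    using IH ev c x y by (simp add: a_ac)
qed

section \<open>Frobenius maps and the relative trace from \<open>R\<close> to
  \<open>F\<close>\<close>

locale finite_field_extension = field R for R (structure) +
  fixes F :: "'a set" and q t r :: nat
  assumes primepow_q: "primepow q"
    and finite_carrier: "finite (carrier R)"
    and card_carrier: "card (carrier R) = q ^ (t * r)"
    and subfield_F: "subfield F R"
    and card_F: "card F = q ^ t"
    and t_pos: "t > 0" and r_pos: "r > 0"
begin

abbreviation Tr :: "'a \<Rightarrow> 'a" where "Tr \<equiv> rel_trace R q t r"

lemma F_subset: "F \<subseteq> carrier R"
  by (rule subfieldE(3)[OF subfield_F])

lemma q_gt_1: "q > 1"
  using primepow_gt_Suc_0[OF primepow_q] by simp

text \<open>If \<open>q = p ^ k\<close>, the order of \<open>R\<close> is a power of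
  \<open>p\<close>, so the characteristic is \<open>p\<close>, and the \<open>q ^ i\<close>-power
  map is the \<open>k * i\<close>-th iterate of the \<open>p\<close>-power map.\<close>

lemma frobenius_hom: "(\<lambda>x. x [^] (q ^ i)) \<in> ring_hom R R"
proof -
  obtain p k where p: "prime p" and k: "k > 0" and q: "q = p ^ k"
    using primepow_q unfolding primepow_def by blast
  have "[p] \<cdot> \<one> = \<zero>"
    using card_carrier k t_pos r_pos finite_carrier
    by (intro prime_power_card_char[of p "k * (t * r)"]) (auto simp: q power_mult)
  from prime_char_pow_hom[OF p this, of "k * i"] show ?thesis
    by (simp add: q power_mult)
qed

lemma frobenius_add:
  assumes "x \<in> carrier R" "y \<in> carrier R"
  shows "(x \<oplus> y) [^] (q ^ i) = x [^] (q ^ i) \<oplus> y [^] (q ^ i)"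
  using ring_hom_add[OF frobenius_hom] assms by fast

lemma pow_fixed_if_mem_F:
  assumes "x \<in> F"
  shows "x [^] (q ^ (t * j)) = x"
proof (induction j)
  case 0
  show ?case using assms F_subset by auto
next
  case (Suc j)
  \<comment> \<open>Viewed as a field of its own, \<open>F\<close> has order \<open>q ^ t\<close>,
    so its elements are fixed by the \<open>q ^ t\<close>-power map.\<close>
  interpret F: field "R\<lparr>carrier := F\<rparr>"
    by (rule subfield_iff(2)[OF subfield_F])
  have "finite F" using F_subset finite_carrier finite_subset by blast
  then have "x [^] (q ^ t) = x"
    using F.pow_card_eq_self[of x] assms card_F nat_pow_consistent[of x "q ^ t" F] by simp
  then show ?case
    using Suc assms F_subset nat_pow_pow[of x "q ^ t" "q ^ (t * j)"]
    by (auto simp: power_add)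
qed

text \<open>The fixed points are \<open>\<zero>\<close> and roots of unity of order dividing
  \<open>q ^ t - 1\<close>, hence at most \<open>q ^ t\<close> in number. The elements of
  \<open>F\<close> are fixed and already reach this bound.\<close>

lemma mem_F_iff:
  assumes "x \<in> carrier R"
  shows "x \<in> F \<longleftrightarrow> x [^] (q ^ t) = x"
proof -
  define S where "S = {x \<in> carrier R. x [^] (q ^ t) = x}"
  define S' where "S' = {x \<in> carrier R. x [^] (q ^ t - 1) = \<one>}"
  have qt: "q ^ t > 1" by (rule one_less_power[OF q_gt_1 t_pos])
  have "S \<subseteq> insert \<zero> S'"
  proof
    fix x assume "x \<in> S"
    then have x: "x \<in> carrier R" "x [^] (q ^ t) = x" by (auto simp: S_def)
    have "Suc (q ^ t - 1) = q ^ t" using qt by simp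
    then have "x [^] (q ^ t - 1) \<otimes> x = \<one> \<otimes> x"
      using x by (metis l_one nat_pow_Suc)
    then have "x = \<zero> \<or> x [^] (q ^ t - 1) = \<one>"
      using x m_rcancel by blast
    then show "x \<in> insert \<zero> S'" using x by (auto simp: S'_def)
  qed
  moreover have "finite S'" using finite_carrier by (simp add: S'_def)
  ultimately have "card S \<le> card (insert \<zero> S')"
    by (intro card_mono) auto
  also have "\<dots> \<le> Suc (card S')"
    using \<open>finite S'\<close> by (simp add: card_insert_if)
  also have "card S' \<le> q ^ t - 1"
    unfolding S'_def using qt by (intro num_roots_le_deg finite_carrier) simp
  finally have "card S \<le> card F"
    using qt by (simp add: card_F)
  moreover have "F \<subseteq> S"
    using pow_fixed_if_mem_F[of _ 1] F_subset by (auto simp: S_def)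
  moreover have "finite S" using finite_carrier by (simp add: S_def)
  ultimately have "F = S" by (intro card_seteq)
  then show ?thesis using assms by (auto simp: S_def)
qed

lemma trace_closed: "x \<in> carrier R \<Longrightarrow> Tr x \<in> carrier R"
  unfolding rel_trace_def by (intro finsum_closed) auto

lemma trace_add:
  assumes "x \<in> carrier R" "y \<in> carrier R"
  shows "Tr (x \<oplus> y) = Tr x \<oplus> Tr y"
  unfolding rel_trace_def using assms by (simp add: frobenius_add finsum_addf Pi_def)

text \<open>The trace is a sum of Frobenius images, so additivity together with commuting with each
  of these powers is enough. It is applied to multiplication by an element of \<open>F\<close> and
  later to f(x) - a x.\<close>

lemma trace_commute:
  assumes g: "g \<in> carrier R \<rightarrow> carrier R"
    and add: "\<And>x y. x \<in> carrier R \<Longrightarrow> y \<in> carrier R \<Longrightarrow> g (x \<oplus> y) = g x \<oplus> g y"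
    and frob: "\<And>x j. x \<in> carrier R \<Longrightarrow> g (x [^] (q ^ (t * j))) = g x [^] (q ^ (t * j))"
    and x: "x \<in> carrier R"
  shows "Tr (g x) = g (Tr x)"
  unfolding rel_trace_def using x
  by (subst additive_finsum[OF g add]) (auto simp: frob)

lemma trace_smult:
  assumes c: "c \<in> F" and x: "x \<in> carrier R"
  shows "Tr (c \<otimes> x) = c \<otimes> Tr x"
proof -
  have "c \<in> carrier R" using c F_subset by auto
  then show ?thesis
    using x by (intro trace_commute)
      (auto simp: r_distr nat_pow_distrib pow_fixed_if_mem_F[OF c])
qed

text \<open>Raising to the power \<open>q ^ t\<close> permutes the summands cyclically: the index
  moves up by one, and the last summand becomes \<open>x\<close> again because \<open>R\<close> has
  \<open>q ^ (t * r)\<close> elements. So the trace is a fixed point.\<close>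

lemma trace_mem_F:
  assumes x: "x \<in> carrier R"
  shows "Tr x \<in> F"
proof -
  let ?h = "\<lambda>j. x [^] (q ^ (t * j))"
  obtain m where m: "r = Suc m" using r_pos gr0_implies_Suc by blast
  have h: "?h \<in> A \<rightarrow> carrier R" for A using x by auto
  have "Tr x [^] (q ^ t) = (\<Oplus>j\<in>{..<r}. ?h j [^] (q ^ t))"
    unfolding rel_trace_def
    by (rule additive_finsum[where g = "\<lambda>x. x [^] (q ^ t)"]) (use x in \<open>auto simp: frobenius_add\<close>)
  also have "\<dots> = (\<Oplus>j\<in>{..<r}. ?h (Suc j))"
    using x by (intro finsum_cong) (auto simp: nat_pow_pow power_add mult.commute)
  also have "\<dots> = (\<Oplus>j\<in>{..<m}. ?h (Suc j)) \<oplus> ?h r"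
    unfolding m lessThan_Suc using x by (subst finsum_insert) (auto simp: a_comm)
  also have "?h r = ?h 0"
    using pow_card_eq_self[OF finite_carrier x] x by (simp add: card_carrier)
  also have "(\<Oplus>j\<in>{..<m}. ?h (Suc j)) \<oplus> ?h 0 = ?h 0 \<oplus> (\<Oplus>j\<in>Suc ` {..<m}. ?h j)"
    using x by (subst finsum_reindex) (auto simp: a_comm)
  also have "\<dots> = Tr x"
    unfolding rel_trace_def m lessThan_Suc_eq_insert_0 using x
    by (subst finsum_insert) auto
  finally show ?thesis using mem_F_iff trace_closed x by blast
qed

text \<open>The trace is a power sum with distinct exponents \<open>q ^ (t * j)\<close>, all below
  the order \<open>q ^ (t * r)\<close> of \<open>R\<close>.\<close>

lemma trace_nonzero: "\<exists>x\<in>carrier R. Tr x \<noteq> \<zero>"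
proof -
  let ?e = "\<lambda>j. q ^ (t * j)"
  have inj: "inj_on ?e {..<r}"
    using q_gt_1 t_pos by (auto simp: inj_on_def)
  have "\<exists>x\<in>carrier R. (\<Oplus>e\<in>?e ` {..<r}. x [^] e) \<noteq> \<zero>"
    using finite_carrier r_pos q_gt_1 t_pos
    by (intro exists_nonroot_of_power_sum) (auto simp: card_carrier)
  moreover have "(\<Oplus>e\<in>?e ` {..<r}. x [^] e) = Tr x" if "x \<in> carrier R" for x
    unfolding rel_trace_def using that inj by (subst finsum_reindex) auto
  ultimately show ?thesis by auto
qed

lemma trace_mult_combination:
  assumes \<delta>: "\<delta> \<in> carrier R" and "finite A"
    and k: "\<And>i. i \<in> A \<Longrightarrow> k i \<in> F" and w: "\<And>i. i \<in> A \<Longrightarrow> w i \<in> carrier R"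
  shows "Tr (\<delta> \<otimes> (\<Oplus>i\<in>A. k i \<otimes> w i)) = (\<Oplus>i\<in>A. k i \<otimes> Tr (\<delta> \<otimes> w i))"
proof -
  have kc: "k i \<in> carrier R" if "i \<in> A" for i using k F_subset that by auto
  have "\<delta> \<otimes> (\<Oplus>i\<in>A. k i \<otimes> w i) = (\<Oplus>i\<in>A. \<delta> \<otimes> (k i \<otimes> w i))"
    using \<open>finite A\<close> \<delta> w kc by (subst finsum_rdistr) auto
  also have "\<dots> = (\<Oplus>i\<in>A. k i \<otimes> (\<delta> \<otimes> w i))"
    using \<delta> w kc by (intro finsum_cong) (auto simp: m_lcomm simp_implies_def)
  finally have "Tr (\<delta> \<otimes> (\<Oplus>i\<in>A. k i \<otimes> w i)) = Tr (\<Oplus>i\<in>A. k i \<otimes> (\<delta> \<otimes> w i))" by simp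
  also have "\<dots> = (\<Oplus>i\<in>A. Tr (k i \<otimes> (\<delta> \<otimes> w i)))"
    by (rule additive_finsum) (use trace_closed trace_add kc w \<delta> \<open>finite A\<close> in auto)
  also have "\<dots> = (\<Oplus>i\<in>A. k i \<otimes> Tr (\<delta> \<otimes> w i))"
    using k kc w \<delta> trace_closed by (intro finsum_cong) (auto simp: trace_smult simp_implies_def)
  finally show ?thesis .
qed

text \<open>A counting argument: sending \<open>\<alpha>\<close> to the tuple of traces
  \<open>Tr (\<alpha> \<otimes> w i)\<close> is injective by nondegeneracy of the trace form, and
  \<open>R\<close> has as many elements as there are \<open>r\<close>-tuples over \<open>F\<close>.
  Hence every tuple is attained.\<close>

lemma exists_trace_dual:
  assumes w: "\<And>i. w i \<in> carrier R"
    and span: "\<And>y. y \<in> carrier R \<Longrightarrow>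
      \<exists>k. (\<forall>i<r. k i \<in> F) \<and> y = (\<Oplus>i\<in>{..<r}. k i \<otimes> w i)"
    and v: "\<And>i. i < r \<Longrightarrow> v i \<in> F"
  shows "\<exists>\<alpha>\<in>carrier R. \<forall>i<r. Tr (\<alpha> \<otimes> w i) = v i"
proof -
  define \<Phi> where "\<Phi> \<alpha> = (\<lambda>i\<in>{..<r}. Tr (\<alpha> \<otimes> w i))" for \<alpha>
  \<comment> \<open>Nondegeneracy: for invertible \<open>\<delta>\<close> every \<open>x\<close> is
    \<open>\<delta>\<close> times an \<open>F\<close>-combination of the \<open>w i\<close>, so the
    trace would vanish on all of \<open>R\<close>.\<close>
  have zero: "\<delta> = \<zero>" if \<delta>: "\<delta> \<in> carrier R" and *: "\<And>i. i < r \<Longrightarrow> Tr (\<delta> \<otimes> w i) = \<zero>" for \<delta>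
  proof (rule ccontr)
    assume "\<delta> \<noteq> \<zero>"
    obtain x where x: "x \<in> carrier R" "Tr x \<noteq> \<zero>" using trace_nonzero by blast
    have inv: "inv \<delta> \<in> carrier R" "\<delta> \<otimes> inv \<delta> = \<one>"
      using \<delta> \<open>\<delta> \<noteq> \<zero>\<close> field_Units by auto
    then obtain k where k: "\<forall>i<r. k i \<in> F" "inv \<delta> \<otimes> x = (\<Oplus>i\<in>{..<r}. k i \<otimes> w i)"
      using span[of "inv \<delta> \<otimes> x"] x by auto
    have "x = \<delta> \<otimes> (inv \<delta> \<otimes> x)" using inv x \<delta> by (simp flip: m_assoc)
    then have "Tr x = (\<Oplus>i\<in>{..<r}. k i \<otimes> Tr (\<delta> \<otimes> w i))"
      using trace_mult_combination[of \<delta> "{..<r}" k w] k \<delta> w by simp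
    also have "\<dots> = \<zero>"
      using k(1) F_subset by (intro add.finprod_one_eqI) (auto simp: *)
    finally show False using x by simp
  qed
  have "inj_on \<Phi> (carrier R)"
  proof (rule inj_onI)
    fix x y assume xy: "x \<in> carrier R" "y \<in> carrier R" "\<Phi> x = \<Phi> y"
    have "Tr ((x \<ominus> y) \<otimes> w i) = \<zero>" if "i < r" for i
    proof -
      have "Tr (x \<otimes> w i) = Tr ((x \<ominus> y) \<otimes> w i \<oplus> y \<otimes> w i)"
        using xy w by (simp flip: l_distr add: a_minus_def a_assoc l_neg)
      also have "\<dots> = Tr ((x \<ominus> y) \<otimes> w i) \<oplus> Tr (y \<otimes> w i)"
        using xy w by (intro trace_add) auto
      also have "Tr (y \<otimes> w i) = Tr (x \<otimes> w i)"
        using xy(3) that by (auto simp: \<Phi>_def dest: fun_cong[of _ _ i])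
      finally show ?thesis
        using xy w by (metis add.l_cancel_one' m_closed minus_closed trace_closed add.r_cancel_one')
    qed
    then have "x \<ominus> y = \<zero>" using xy(1,2) by (metis zero minus_closed)
    then show "x = y" using xy(1,2) by simp
  qed
  then have "card (\<Phi> ` carrier R) = card ({..<r} \<rightarrow>\<^sub>E F)"
    by (simp add: card_image card_carrier card_PiE card_F power_mult)
  moreover have "\<Phi> ` carrier R \<subseteq> {..<r} \<rightarrow>\<^sub>E F"
    by (simp add: \<Phi>_def image_subset_iff restrict_PiE_iff trace_mem_F w)
  moreover have "finite ({..<r} \<rightarrow>\<^sub>E F)"
    using F_subset finite_carrier finite_subset by (intro finite_PiE) auto
  ultimately have "\<Phi> ` carrier R = ({..<r} \<rightarrow>\<^sub>E F)"
    by (intro card_subset_eq)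
  moreover have "(\<lambda>i\<in>{..<r}. v i) \<in> {..<r} \<rightarrow>\<^sub>E F"
    using v by (simp add: restrict_PiE_iff)
  ultimately obtain \<alpha> where "\<alpha> \<in> carrier R" "\<Phi> \<alpha> = (\<lambda>i\<in>{..<r}. v i)"
    by (metis (no_types, lifting) imageE)
  moreover from this have "Tr (\<alpha> \<otimes> w i) = v i" if "i < r" for i
    using that by (auto simp: \<Phi>_def dest: fun_cong[of _ _ i])
  ultimately show ?thesis by blast
qed

end

section \<open>Invertible matrices acting on linear sets\<close>

lemma (in domain) mat2_kernel_trivial:
  assumes cl: "a \<in> carrier R" "b \<in> carrier R" "c \<in> carrier R" "d \<in> carrier R"
    and det: "a \<otimes> d \<ominus> b \<otimes> c \<noteq> \<zero>"
    and u: "u \<in> carrier R \<times> carrier R"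
    and zero: "mat2_apply R a b c d u = (\<zero>, \<zero>)"
  shows "u = (\<zero>, \<zero>)"
proof -
  obtain x y where xy: "u = (x, y)" "x \<in> carrier R" "y \<in> carrier R" using u by auto
  have e: "a \<otimes> x \<oplus> b \<otimes> y = \<zero>" "c \<otimes> x \<oplus> d \<otimes> y = \<zero>"
    using zero by (auto simp: mat2_apply_def xy)
  \<comment> \<open>This identity and its counterpart for \<open>y\<close> come from multiplying by
    the adjugate matrix.\<close>
  have "(a \<otimes> d \<ominus> b \<otimes> c) \<otimes> x = d \<otimes> (a \<otimes> x \<oplus> b \<otimes> y) \<ominus> b \<otimes> (c \<otimes> x \<oplus> d \<otimes> y)"
    using cl xy by algebra
  then have "(a \<otimes> d \<ominus> b \<otimes> c) \<otimes> x = \<zero>" using e cl by simp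
  moreover have "(a \<otimes> d \<ominus> b \<otimes> c) \<otimes> y = a \<otimes> (c \<otimes> x \<oplus> d \<otimes> y) \<ominus> c \<otimes> (a \<otimes> x \<oplus> b \<otimes> y)"
    using cl xy by algebra
  then have "(a \<otimes> d \<ominus> b \<otimes> c) \<otimes> y = \<zero>" using e cl by simp
  ultimately show ?thesis using det xy cl by (simp add: integral_iff)
qed

text \<open>By linearity the matrix carries the point of \<open>u\<close> to the point of its image.
  Its kernel is trivial, so the zero vector may be removed before or after taking images.\<close>

lemma (in domain) PGL_equivalent_linear_setI:
  assumes cl: "a \<in> carrier R" "b \<in> carrier R" "c \<in> carrier R" "d \<in> carrier R"
    and det: "a \<otimes> d \<ominus> b \<otimes> c \<noteq> \<zero>"
    and U: "U \<subseteq> carrier R \<times> carrier R"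
  shows "PGL_equivalent R (linear_set R U) (linear_set R (mat2_apply R a b c d ` U))"
proof -
  let ?M = "mat2_apply R a b c d"
  have point: "?M ` proj_point R u = proj_point R (?M u)" if "u \<in> U" for u
  proof -
    have u: "fst u \<in> carrier R" "snd u \<in> carrier R" using U that by auto
    have "?M (k \<otimes> fst u, k \<otimes> snd u) = (k \<otimes> fst (?M u), k \<otimes> snd (?M u))"
      if "k \<in> carrier R" for k
      using cl u that by (simp add: mat2_apply_def r_distr m_lcomm)
    then show ?thesis
      unfolding proj_point_def Setcompr_eq_image image_image by (intro image_cong) auto
  qed
  have "?M (\<zero>, \<zero>) = (\<zero>, \<zero>)" using cl by (simp add: mat2_apply_def)
  then have "?M u = (\<zero>, \<zero>) \<longleftrightarrow> u = (\<zero>, \<zero>)" if "u \<in> U" for u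
    using mat2_kernel_trivial[OF cl det] U that by blast
  then have "U - {(\<zero>, \<zero>)} = {u \<in> U. ?M u \<noteq> (\<zero>, \<zero>)}"
    by auto
  moreover have "?M ` U - {(\<zero>, \<zero>)} = ?M ` {u \<in> U. ?M u \<noteq> (\<zero>, \<zero>)}" by auto
  ultimately have "?M ` U - {(\<zero>, \<zero>)} = ?M ` (U - {(\<zero>, \<zero>)})" by simp
  then have "(`) ?M ` linear_set R U = linear_set R (?M ` U)"
    unfolding linear_set_def using point by (auto simp: image_image intro!: image_cong)
  then show ?thesis
    unfolding PGL_equivalent_def projectivities_def using cl det by blast
qed

section \<open>The explicit projectivity between the two linear sets\<close>

lemma (in finite_field_extension) PGL_equivalent_U_ab_U_graph:
  assumes f_q: "f \<in> q_polys R q F" and a_F: "a \<in> F" and b_F: "b \<in> F" and b_nz: "b \<noteq> \<zero>"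
    and \<omega>_closed: "\<omega> \<in> carrier R"
    and basis: "is_basis R F (map (\<lambda>i. \<omega> [^] i) [0..<r])"
  shows "PGL_equivalent R (linear_set R (U_ab R F r f \<omega> a b))
    (linear_set R (U_graph R (\<lambda>x. Tr (eval f x \<ominus> a \<otimes> x))))"
proof -
  define g where "g x = eval f x \<ominus> a \<otimes> x" for x
  have a: "a \<in> carrier R" and b: "b \<in> carrier R" "b \<noteq> \<zero>" and \<omega>: "\<omega> \<in> carrier R"
    using a_F b_F b_nz \<omega>_closed F_subset by auto
  have fF: "set f \<subseteq> F"
    using f_q polynomial_incl unfolding q_polys_def by (auto simp flip: univ_poly_carrier)
  then have f: "set f \<subseteq> carrier R" using F_subset by blast
  have supp: "k \<in> range (\<lambda>i. q ^ i)" if "coeff f k \<noteq> \<zero>" for k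
    using f_q that unfolding q_polys_def by auto
  have eval_closed: "eval f x \<in> carrier R" if "x \<in> carrier R" for x
    using eval_in_carrier[OF f that] .
  have eval_add: "eval f (x \<oplus> y) = eval f x \<oplus> eval f y"
    if "x \<in> carrier R" "y \<in> carrier R" for x y
    by (rule eval_additive_of_support[OF f supp _ that]) (auto simp: frobenius_add)
  have g_closed: "g \<in> carrier R \<rightarrow> carrier R"
    using a eval_closed by (auto simp: g_def)
  have g_add: "g (x \<oplus> y) = g x \<oplus> g y" if "x \<in> carrier R" "y \<in> carrier R" for x y
    using that a eval_closed
    by (simp add: g_def eval_add a_minus_def r_distr minus_add a_ac)
  \<comment> \<open>A ring homomorphism acts on \<open>eval f x\<close> through the coefficients and
    the argument; here the coefficients of \<open>f\<close> and the element \<open>a\<close> lie in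
    \<open>F\<close> and are fixed.\<close>
  have g_frob: "g (x [^] (q ^ (t * j))) = g x [^] (q ^ (t * j))" if x: "x \<in> carrier R" for x j
  proof -
    let ?\<sigma> = "\<lambda>x. x [^] (q ^ (t * j))"
    interpret S: ring_hom_ring R R ?\<sigma>
      by (rule ring_hom_ringI2[OF ring_axioms ring_axioms frobenius_hom])
    have "map ?\<sigma> f = f"
      using fF pow_fixed_if_mem_F by (intro map_idI) auto
    then have "?\<sigma> (eval f x) = eval f (?\<sigma> x)"
      using S.eval_hom'[OF x f] by simp
    moreover have "?\<sigma> (a \<otimes> x) = a \<otimes> ?\<sigma> x"
      using a x pow_fixed_if_mem_F[OF a_F] by (simp add: nat_pow_distrib)
    moreover have "?\<sigma> (eval f x \<oplus> \<ominus> (a \<otimes> x)) = ?\<sigma> (eval f x) \<oplus> \<ominus> ?\<sigma> (a \<otimes> x)"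
      using a x eval_closed by simp
    ultimately show ?thesis
      by (simp add: g_def a_minus_def)
  qed
  have trace_g: "Tr (g x) = g (Tr x)" if "x \<in> carrier R" for x
    by (rule trace_commute[OF g_closed g_add g_frob that])

  have span: "\<exists>k. (\<forall>i<r. k i \<in> F) \<and> y = (\<Oplus>i\<in>{..<r}. k i \<otimes> \<omega> [^] i)" if "y \<in> carrier R" for y
  proof -
    let ?us = "map (\<lambda>i. \<omega> [^] i) [0..<r]"
    have "y \<in> Span F ?us" using basis that by (simp add: is_basis_def)
    moreover have "set ?us \<subseteq> carrier R" using \<omega> by auto
    ultimately obtain ks where ks: "set ks \<subseteq> F" "length ks = r" "y = combine ks ?us"
      using Span_mem_iff_length_version[OF subfield_F] by auto
    then have "y = (\<Oplus>i\<in>{..<r}. ks ! i \<otimes> \<omega> [^] i)"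
      using combine_map_upt_eq_finsum[of ks "\<lambda>i. \<omega> [^] i"] \<omega> F_subset by auto
    moreover have "\<forall>i<r. ks ! i \<in> F" using ks nth_mem by blast
    ultimately show ?thesis by blast
  qed
  have zero_one: "\<zero> \<in> F" "\<one> \<in> F"
    using subringE(2,3)[OF subfieldE(1)[OF subfield_F]] .
  \<comment> \<open>This \<open>\<alpha>\<close> belongs to the trace-dual basis of the powers of
    \<open>\<omega>\<close>: its trace form reads off the coordinate at
    \<open>\<omega> [^] 0\<close>.\<close>
  have "\<exists>\<alpha>\<in>carrier R. \<forall>i<r. Tr (\<alpha> \<otimes> \<omega> [^] i) = (if i = 0 then \<one> else \<zero>)"
    by (rule exists_trace_dual[OF _ span]) (use \<omega> zero_one in auto)
  then obtain \<alpha> where \<alpha>: "\<alpha> \<in> carrier R"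
    and dual: "\<And>i. i < r \<Longrightarrow> Tr (\<alpha> \<otimes> \<omega> [^] i) = (if i = 0 then \<one> else \<zero>)"
    by blast
  have "\<alpha> \<noteq> \<zero>"
    using dual[of 0] trace_smult[OF zero_one(1) zero_closed] trace_closed[OF zero_closed] r_pos
    by auto
  \<comment> \<open>The factor \<open>inv b\<close> cancels the coefficient \<open>b\<close> of
    \<open>x 0\<close>; it lies in \<open>F\<close> and therefore passes through the trace.\<close>
  define \<mu> where "\<mu> = inv b \<otimes> \<alpha>"
  have inv_b: "inv b \<in> carrier R" "inv b \<otimes> b = \<one>" "b \<otimes> inv b = \<one>" "inv b \<noteq> \<zero>"
    using b field_Units by (auto simp: nonzero_imp_inverse_nonzero)
  have inv_b_F: "inv b \<in> F"
    using subfield_m_inv(1)[OF subfield_F] b_F b by auto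
  have \<mu>: "\<mu> \<in> carrier R" "\<mu> \<noteq> \<zero>"
    using \<alpha> \<open>\<alpha> \<noteq> \<zero>\<close> inv_b by (auto simp: \<mu>_def integral_iff)
  have inv_\<mu>: "inv \<mu> \<in> carrier R" "\<mu> \<otimes> inv \<mu> = \<one>"
    using \<mu> field_Units by auto

  define Y where "Y x = b \<otimes> x 0 \<oplus> (\<Oplus>i\<in>{1..r - 1}. x i \<otimes> \<omega> [^] i)" for x :: "nat \<Rightarrow> 'a"
  \<comment> \<open>Absorbing \<open>b\<close> into the coordinate at 0 turns \<open>Y x\<close>
    into an ordinary combination of the basis.\<close>
  have Y_eq: "Y x = (\<Oplus>i\<in>{..<r}. (x(0 := b \<otimes> x 0)) i \<otimes> \<omega> [^] i)" if x: "\<forall>i<r. x i \<in> F" for x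
  proof -
    have xc: "x i \<in> carrier R" if "i < r" for i using x that F_subset by auto
    have "{..<r} = insert 0 {1..r - 1}" using r_pos by auto
    moreover have "(\<Oplus>i\<in>{1..r - 1}. (x(0 := b \<otimes> x 0)) i \<otimes> \<omega> [^] i)
        = (\<Oplus>i\<in>{1..r - 1}. x i \<otimes> \<omega> [^] i)"
      using xc \<omega> by (intro finsum_cong) (auto simp: simp_implies_def)
    moreover have "(\<Oplus>i\<in>insert 0 {1..r - 1}. (x(0 := b \<otimes> x 0)) i \<otimes> \<omega> [^] i)
        = b \<otimes> x 0 \<oplus> (\<Oplus>i\<in>{1..r - 1}. (x(0 := b \<otimes> x 0)) i \<otimes> \<omega> [^] i)"
      using xc \<omega> b r_pos by (subst finsum_insert) auto
    ultimately show ?thesis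
      unfolding Y_def by (simp only:)
  qed
  have Y_closed: "Y x \<in> carrier R" if x: "\<forall>i<r. x i \<in> F" for x
  proof -
    have "x i \<in> carrier R" if "i < r" for i using x that F_subset by auto
    then show ?thesis
      unfolding Y_def using b \<omega> r_pos by (intro a_closed m_closed finsum_closed) auto
  qed
  have trace_Y: "Tr (\<mu> \<otimes> Y x) = x 0" if x: "\<forall>i<r. x i \<in> F" for x
  proof -
    let ?k = "x(0 := b \<otimes> x 0)"
    have xc: "x i \<in> carrier R" if "i < r" for i using x that F_subset by auto
    then have x0: "x 0 \<in> carrier R" using r_pos by simp
    have k: "?k i \<in> F" if "i < r" for i
      using x that b_F subringE(6)[OF subfieldE(1)[OF subfield_F]] by auto
    have "Tr (\<mu> \<otimes> Y x) = inv b \<otimes> Tr (\<alpha> \<otimes> Y x)"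
      unfolding \<mu>_def using trace_smult[OF inv_b_F] \<alpha> inv_b Y_closed[OF x] by (simp add: m_assoc)
    also have "Tr (\<alpha> \<otimes> Y x) = (\<Oplus>i\<in>{..<r}. ?k i \<otimes> Tr (\<alpha> \<otimes> \<omega> [^] i))"
      unfolding Y_eq[OF x] using k \<alpha> \<omega> by (intro trace_mult_combination) auto
    also have "\<dots> = (\<Oplus>i\<in>{..<r}. if i = 0 then b \<otimes> x 0 else \<zero>)"
      using xc b x0 dual by (intro finsum_cong) (auto simp: simp_implies_def)
    also have "\<dots> = b \<otimes> x 0"
      using add.finprod_singleton_swap[of 0 "{..<r}" "\<lambda>_. b \<otimes> x 0"] r_pos b x0 by simp
    finally show ?thesis using inv_b x0 b by (simp flip: m_assoc)
  qed

  have U: "U_ab R F r f \<omega> a b = {(g (x 0), Y x) | x. \<forall>i<r. x i \<in> F}"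
    by (simp add: U_ab_def g_def Y_def)
  \<comment> \<open>The matrix swaps the coordinates and scales one of them by \<open>\<mu>\<close>;
    its determinant is the negative of \<open>\<mu>\<close>.\<close>
  have M: "mat2_apply R \<zero> \<mu> \<one> \<zero> (u, y) = (\<mu> \<otimes> y, u)" if "u \<in> carrier R" "y \<in> carrier R" for u y
    using that \<mu> by (simp add: mat2_apply_def)
  have U_closed: "g (x 0) \<in> carrier R" "Y x \<in> carrier R" if "\<forall>i<r. x i \<in> F" for x
    using that g_closed F_subset r_pos Y_closed by auto
  have image: "mat2_apply R \<zero> \<mu> \<one> \<zero> ` U_ab R F r f \<omega> a b = U_graph R (\<lambda>x. Tr (g x))"
  proof (intro equalityI subsetI)
    fix v assume "v \<in> mat2_apply R \<zero> \<mu> \<one> \<zero> ` U_ab R F r f \<omega> a b"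
    then obtain x where x: "\<forall>i<r. x i \<in> F" and v: "v = (\<mu> \<otimes> Y x, g (x 0))"
      using M U_closed unfolding U by auto
    have "g (x 0) = Tr (g (\<mu> \<otimes> Y x))"
      using trace_g trace_Y[OF x] \<mu> Y_closed[OF x] by simp
    then show "v \<in> U_graph R (\<lambda>x. Tr (g x))"
      using v \<mu> Y_closed[OF x] by (auto simp: U_graph_def)
  next
    fix v assume "v \<in> U_graph R (\<lambda>x. Tr (g x))"
    then obtain z where z: "z \<in> carrier R" and v: "v = (z, Tr (g z))"
      by (auto simp: U_graph_def)
    \<comment> \<open>For surjectivity, the required second coordinate
      \<open>inv \<mu> \<otimes> z\<close> is expanded in the basis. Dividing its coordinate at 0 by
      \<open>b\<close> undoes the substitution of \<open>Y_eq\<close> and gives the parameters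
      \<open>x\<close>.\<close>
    obtain k where k: "\<forall>i<r. k i \<in> F" and kz: "inv \<mu> \<otimes> z = (\<Oplus>i\<in>{..<r}. k i \<otimes> \<omega> [^] i)"
      using span[of "inv \<mu> \<otimes> z"] z inv_\<mu> by auto
    define x where "x = k(0 := inv b \<otimes> k 0)"
    have x: "\<forall>i<r. x i \<in> F"
      using k inv_b_F subringE(6)[OF subfieldE(1)[OF subfield_F]] by (auto simp: x_def)
    have "k 0 \<in> carrier R" using k r_pos F_subset by auto
    then have "b \<otimes> x 0 = k 0" using inv_b b by (simp add: x_def flip: m_assoc)
    then have "x(0 := b \<otimes> x 0) = k" by (auto simp: x_def)
    then have "Y x = inv \<mu> \<otimes> z" using Y_eq[OF x] kz by simp
    then have "\<mu> \<otimes> Y x = z" using inv_\<mu> \<mu> z by (simp flip: m_assoc)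
    moreover from this have "g (x 0) = Tr (g z)"
      using trace_g[OF z] trace_Y[OF x] by simp
    ultimately have "v = mat2_apply R \<zero> \<mu> \<one> \<zero> (g (x 0), Y x)"
      using v M U_closed[OF x] by simp
    then show "v \<in> mat2_apply R \<zero> \<mu> \<one> \<zero> ` U_ab R F r f \<omega> a b"
      unfolding U using x by blast
  qed
  have "\<zero> \<otimes> \<zero> \<ominus> \<mu> \<otimes> \<one> \<noteq> \<zero>"
    using \<mu> by (simp add: a_minus_def)
  moreover have "U_ab R F r f \<omega> a b \<subseteq> carrier R \<times> carrier R"
    unfolding U using U_closed by auto
  ultimately have "PGL_equivalent R (linear_set R (U_ab R F r f \<omega> a b))
      (linear_set R (U_graph R (\<lambda>x. Tr (g x))))"
    using PGL_equivalent_linear_setI[of \<zero> \<mu> \<one> \<zero> "U_ab R F r f \<omega> a b"] \<mu> image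
    by simp
  then show ?thesis by (simp add: g_def)
qed

theorem theorem5p3:
  fixes R :: "('a, 'b) ring_scheme"
    and K F :: "'a set"
    and q n t r :: nat
    and f :: "'a list"
    and a b \<omega> :: 'a
  assumes "primepow q"
    and "n = t * r" and "t > 1" and "r > 1"
    and "field R" and "finite (carrier R)" and "card (carrier R) = q ^ n"
    and "subfield F R" and "card F = q ^ t"
    and "subfield K R" and "card K = q"
    and "f \<in> q_polys R q F" and "scattered R K F f"
    and "a \<in> F" and "b \<in> F" and "b \<noteq> \<zero>\<^bsub>R\<^esub>"
    and "\<omega> \<in> carrier R"
    and "is_basis R F (map (\<lambda>i. \<omega> [^]\<^bsub>R\<^esub> i) [0..<r])"
  shows "PGL_equivalent R
    (linear_set R (U_ab R F r f \<omega> a b))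
    (linear_set R (U_graph R
      (\<lambda>x. rel_trace R q t r (ring.eval R f x \<ominus>\<^bsub>R\<^esub> a \<otimes>\<^bsub>R\<^esub> x))))"
proof -
  interpret finite_field_extension R F q t r
    by (intro finite_field_extension.intro finite_field_extension_axioms.intro)
      (use assms(1-9) in simp_all)
  show ?thesis
    by (rule PGL_equivalent_U_ab_U_graph) (use assms in simp_all)
qed

end
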